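(* If $p\ge 3$ and $n\ge 1$, then $\chi_i(S_p^n)=p$. Moreover, $S_p^n$ is perfect injectively colorable.
   Context: For integers $p\ge1$, $n\ge1$, the Sierpiński graph $S_p^n$ has vertex set $[p]^n$, where $[p]=\{1,\ldots,p\}$, and two vertices $(u_1,\ldots,u_n)$ and $(v_1,\ldots,v_n)$ are adjacent if there is an index $d\in[n]$ such that $u_i=v_i$ for $i<d$, $u_d\neq v_d$, and $v_i=u_d$ and $u_i=v_d$ for all $i\in\{d+1,\ldots,n\}$. An injective $k$-coloring of a graph $G$ is a map $f:V(G)\to\{1,\dots,k\}$ such that no vertex has two neighbors $u\neq w$ with $f(u)=f(w)$; $\chi_i(G)$ is the least such $k$. A set $B\subseteq V(G)$ is an open packing if $N(u)\cap N(v)=\emptyset$ for all distinct $u,v\in B$ (where $N(x)$ is the open neighborhood); $\rho^{\rm o}(G)$ is the maximum cardinality of an open packing. $G$ is perfect injectively colorable if it has an injective coloring in which every color class is an open packing of cardinality $\rho^{\rm o}(G)$. *)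

theory Defs
  imports "Graph_Theory.Pair_Digraph"
begin

text \<open>
  Finite simple graphs are the digraphs satisfying \<^locale>\<open>pair_graph\<close> (finite, loop-free, with a
  symmetric arc set); an edge is a pair of opposite arcs.
\<close>

definition open_nbhd :: "'a pair_pre_digraph \<Rightarrow> 'a \<Rightarrow> 'a set" where
  "open_nbhd G x = {y. (x, y) \<in> parcs G}"

definition injective_coloring :: "'a pair_pre_digraph \<Rightarrow> nat \<Rightarrow> ('a \<Rightarrow> nat) \<Rightarrow> bool" where
  "injective_coloring G k f \<longleftrightarrow>
     f ` pverts G \<subseteq> {1..k} \<and>
     \<not> (\<exists>x\<in>pverts G. \<exists>u\<in>open_nbhd G x. \<exists>w\<in>open_nbhd G x. u \<noteq> w \<and> f u = f w)"

definition injective_chromatic_number :: "'a pair_pre_digraph \<Rightarrow> nat" where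
  "injective_chromatic_number G = (LEAST k. \<exists>f. injective_coloring G k f)"

definition open_packing :: "'a pair_pre_digraph \<Rightarrow> 'a set \<Rightarrow> bool" where
  "open_packing G B \<longleftrightarrow>
     B \<subseteq> pverts G \<and> (\<forall>u\<in>B. \<forall>v\<in>B. u \<noteq> v \<longrightarrow> open_nbhd G u \<inter> open_nbhd G v = {})"

definition open_packing_number :: "'a pair_pre_digraph \<Rightarrow> nat" where
  "open_packing_number G = Max {card B | B. open_packing G B}"

text \<open>
  All \<open>k\<close> classes are required to have maximum cardinality, so on a nonempty graph every colour is
  used.
\<close>

definition perfect_injectively_colorable :: "'a pair_pre_digraph \<Rightarrow> bool" where
  "perfect_injectively_colorable G \<longleftrightarrow>
     (\<exists>k f. injective_coloring G k f \<and>
        (\<forall>c\<in>{1..k}. open_packing G {v \<in> pverts G. f v = c} \<and>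
                      card {v \<in> pverts G. f v = c} = open_packing_number G))"

text \<open>
  Vertices are lists of length \<open>n\<close>. List positions, and hence the index \<open>d\<close>, count from 0.
\<close>

definition sierpinski_verts :: "nat \<Rightarrow> nat \<Rightarrow> nat list set" where
  "sierpinski_verts p n = {u. length u = n \<and> set u \<subseteq> {1..p}}"

definition sierpinski_adj :: "nat \<Rightarrow> nat list \<Rightarrow> nat list \<Rightarrow> bool" where
  "sierpinski_adj n u v \<longleftrightarrow>
     (\<exists>d<n. (\<forall>i<d. u ! i = v ! i) \<and> u ! d \<noteq> v ! d \<and>
        (\<forall>i\<in>{d<..<n}. v ! i = u ! d \<and> u ! i = v ! d))"

definition sierpinski_graph :: "nat \<Rightarrow> nat \<Rightarrow> nat list pair_pre_digraph" where
  "sierpinski_graph p n =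
     \<lparr> pverts = sierpinski_verts p n,
       parcs = {(u, v). u \<in> sierpinski_verts p n \<and> v \<in> sierpinski_verts p n \<and>
                        sierpinski_adj n u v} \<rparr>"

lemma finite_sierpinski_verts: "finite (sierpinski_verts p n)"
proof -
  have "sierpinski_verts p n = {u. set u \<subseteq> {1..p} \<and> length u = n}"
    by (auto simp: sierpinski_verts_def)
  then show ?thesis
    using finite_lists_length_eq[of "{1..p}" n] by simp
qed

lemma sierpinski_adj_sym: "sierpinski_adj n u v \<Longrightarrow> sierpinski_adj n v u"
  unfolding sierpinski_adj_def by metis

lemma sierpinski_adj_irrefl: "\<not> sierpinski_adj n u u"
  by (auto simp: sierpinski_adj_def)

lemma pair_graph_sierpinski: "pair_graph (sierpinski_graph p n)"
proof
  show "finite (parcs (sierpinski_graph p n))"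
    by (rule finite_subset[of _ "sierpinski_verts p n \<times> sierpinski_verts p n"])
       (auto simp: sierpinski_graph_def finite_sierpinski_verts)
  show "symmetric (with_proj (sierpinski_graph p n))"
    unfolding symmetric_def
    by (auto simp: sierpinski_graph_def intro!: symI dest: sierpinski_adj_sym)
qed (auto simp: sierpinski_graph_def finite_sierpinski_verts sierpinski_adj_irrefl)

text \<open>
  On finite graphs the minimum and the maximum above are attained.
\<close>

lemma ex_injective_coloring:
  assumes "pair_graph G"
  shows "\<exists>k f. injective_coloring G k f"
proof -
  interpret pair_graph G by (rule assms)
  obtain f where f: "bij_betw f (pverts G) {1..card (pverts G)}"
    using ex_bij_betw_finite_nat[OF pair_finite_verts] pair_finite_verts
    by (metis card_atLeastAtMost diff_Suc_1 finite_atLeastAtMost finite_same_card_bij)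
  have "open_nbhd G x \<subseteq> pverts G" for x
    using in_arcsD2 by (auto simp: open_nbhd_def)
  then have "injective_coloring G (card (pverts G)) f"
    using f unfolding injective_coloring_def bij_betw_def by (metis inj_onD order_refl subsetD)
  then show ?thesis by blast
qed

lemma injective_chromatic_number_attained:
  assumes "pair_graph G"
  shows "\<exists>f. injective_coloring G (injective_chromatic_number G) f"
  unfolding injective_chromatic_number_def
  by (rule LeastI_ex) (rule ex_injective_coloring[OF assms])

lemma open_packing_number_attained:
  assumes "pair_graph G"
  shows "\<exists>B. open_packing G B \<and> card B = open_packing_number G"
    and "open_packing G B \<Longrightarrow> card B \<le> open_packing_number G"
proof -
  interpret pair_graph G by (rule assms)
  let ?C = "{card B | B. open_packing G B}"
  have "?C \<subseteq> {..card (pverts G)}"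
    using card_mono[OF pair_finite_verts] by (auto simp: open_packing_def)
  then have fin: "finite ?C"
    using finite_subset by blast
  have "open_packing G {}"
    by (simp add: open_packing_def)
  then have "?C \<noteq> {}" by blast
  then have "open_packing_number G \<in> ?C"
    unfolding open_packing_number_def using Max_in[OF fin] by blast
  then show "\<exists>B. open_packing G B \<and> card B = open_packing_number G" by auto
  show "card B \<le> open_packing_number G" if "open_packing G B"
    unfolding open_packing_number_def using Max_ge[OF fin] that by blast
qed

end

theory Submission
  imports Defs
begin

text \<open>
  The graph is partitioned into \<open>p\<close>-cliques, whose vertices agree in all but the last letter. As
  \<open>p \<ge> 3\<close>, two vertices of a clique have a common neighbour, so an injective colouring needs \<open>p\<close>
  colours, and an open packing contains at most one vertex of each of the \<open>p ^ (n - 1)\<close> cliques.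
  An injective colouring with \<open>p\<close> colours uses every colour exactly once on each clique, so all its
  classes are open packings of size \<open>p ^ (n - 1)\<close>. Such a colouring must take the same value at
  both ends of every edge between different cliques, and
  \<open>u \<mapsto> 2 ^ (n - 2) * u\<^sub>1 + \<dots> + 2 * u\<^sub>n\<^sub>-\<^sub>2 + u\<^sub>n\<^sub>-\<^sub>1 + u\<^sub>n\<close> modulo \<open>p\<close> does: on \<open>w i j\<dots>j\<close> with \<open>r\<close> letters
  \<open>j\<close>, the last \<open>r + 1\<close> letters contribute \<open>2 ^ (r - 1) * (i + j)\<close>.
\<close>

text \<open>By symmetry of the arcs, a common neighbour of \<open>u\<close> and \<open>v\<close> has
  both among its own neighbours, so the colouring separates them.\<close>

lemma open_packing_color_class:
  assumes G: "pair_graph G" and f: "injective_coloring G k f"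
  shows "open_packing G {v \<in> pverts G. f v = c}"
proof -
  interpret pair_graph G by (rule G)
  have "open_nbhd G u \<inter> open_nbhd G v = {}" if "f u = f v" "u \<noteq> v" for u v
  proof (rule ccontr)
    assume "open_nbhd G u \<inter> open_nbhd G v \<noteq> {}"
    then obtain x where x: "(u, x) \<in> parcs G" "(v, x) \<in> parcs G"
      by (auto simp: open_nbhd_def)
    then have "x \<in> pverts G" "(x, u) \<in> parcs G" "(x, v) \<in> parcs G"
      using in_arcsD2 arcs_symmetric by auto
    with f that show False
      by (auto simp: injective_coloring_def open_nbhd_def)
  qed
  then show ?thesis
    by (auto simp: open_packing_def)
qed

section \<open>Cliques of words that differ only in the last letter\<close>

lemma snoc_in_sierpinski_verts [simp]:
  "w @ [a] \<in> sierpinski_verts p (Suc m) \<longleftrightarrow> w \<in> sierpinski_verts p m \<and> a \<in> {1..p}"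
  by (auto simp: sierpinski_verts_def)

lemma sierpinski_verts_SucE:
  assumes "u \<in> sierpinski_verts p (Suc m)"
  obtains w a where "u = w @ [a]" "w \<in> sierpinski_verts p m" "a \<in> {1..p}"
proof -
  from assms have "u \<noteq> []"
    by (auto simp: sierpinski_verts_def)
  then have "u = butlast u @ [last u]"
    by simp
  with assms that show thesis
    by (metis snoc_in_sierpinski_verts)
qed

lemma card_sierpinski_verts: "card (sierpinski_verts p n) = p ^ n"
  using card_lists_length_eq[of "{1..p}" n]
  by (simp add: sierpinski_verts_def conj_commute)

lemma sierpinski_adj_snoc:
  assumes "w \<in> sierpinski_verts p m" "a \<noteq> b"
  shows "sierpinski_adj (Suc m) (w @ [a]) (w @ [b])"
  unfolding sierpinski_adj_def using assms
  by (intro exI[of _ m]) (auto simp: sierpinski_verts_def nth_append)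

lemma open_nbhd_sierpinski:
  "open_nbhd (sierpinski_graph p n) x =
     (if x \<in> sierpinski_verts p n then {y \<in> sierpinski_verts p n. sierpinski_adj n x y} else {})"
  by (auto simp: open_nbhd_def sierpinski_graph_def)

lemma pverts_sierpinski [simp]: "pverts (sierpinski_graph p n) = sierpinski_verts p n"
  by (simp add: sierpinski_graph_def)

text \<open>As \<open>p \<ge> 3\<close>, some letter \<open>c\<close> differs from \<open>a\<close>
  and \<open>b\<close>, and \<open>w @ [c]\<close> is the neighbour. Adjacency is recorded in both
  directions: the first serves colourings, the second open packings.\<close>

lemma clique_common_neighbour:
  assumes "p \<ge> 3" "w \<in> sierpinski_verts p m" "a \<in> {1..p}" "b \<in> {1..p}"
  obtains x where "x \<in> sierpinski_verts p (Suc m)"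
    "w @ [a] \<in> open_nbhd (sierpinski_graph p (Suc m)) x"
    "w @ [b] \<in> open_nbhd (sierpinski_graph p (Suc m)) x"
    "x \<in> open_nbhd (sierpinski_graph p (Suc m)) (w @ [a])"
    "x \<in> open_nbhd (sierpinski_graph p (Suc m)) (w @ [b])"
proof -
  have "card ({1..p} - {a, b}) \<ge> card {1..p} - card {a, b}"
    by (rule diff_card_le_card_Diff) simp
  moreover have "card {a, b} \<le> 2"
    by (simp add: card_insert_if)
  ultimately have "card ({1..p} - {a, b}) > 0"
    using \<open>p \<ge> 3\<close> by simp
  then obtain c where c: "c \<in> {1..p}" "c \<noteq> a" "c \<noteq> b"
    by (metis DiffE card_gt_0_iff ex_in_conv insertCI)
  then show thesis
    using assms that[of "w @ [c]"] by (simp add: open_nbhd_sierpinski sierpinski_adj_snoc)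
qed

lemma injective_coloring_inj_on_clique:
  assumes "p \<ge> 3" "w \<in> sierpinski_verts p m"
    and f: "injective_coloring (sierpinski_graph p (Suc m)) k f"
  shows "inj_on (\<lambda>a. f (w @ [a])) {1..p}"
proof (rule inj_onI, rule ccontr)
  fix a b assume ab: "a \<in> {1..p}" "b \<in> {1..p}" "f (w @ [a]) = f (w @ [b])" "a \<noteq> b"
  obtain x where "x \<in> sierpinski_verts p (Suc m)"
    "w @ [a] \<in> open_nbhd (sierpinski_graph p (Suc m)) x"
    "w @ [b] \<in> open_nbhd (sierpinski_graph p (Suc m)) x"
    using clique_common_neighbour[OF assms(1,2) ab(1,2)] by blast
  with f ab show False
    unfolding injective_coloring_def pverts_sierpinski by fastforce
qed

lemma injective_coloring_sierpinski_ge: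
  assumes "p \<ge> 3" and f: "injective_coloring (sierpinski_graph p (Suc m)) k f"
  shows "p \<le> k"
proof -
  let ?w = "replicate m (1::nat)"
  have w: "?w \<in> sierpinski_verts p m"
    using \<open>p \<ge> 3\<close> by (auto simp: sierpinski_verts_def)
  have "(\<lambda>a. f (?w @ [a])) ` {1..p} \<subseteq> {1..k}"
    using f w by (auto simp: injective_coloring_def image_subset_iff)
  from card_inj_on_le[OF injective_coloring_inj_on_clique[OF assms(1) w f] this]
  show ?thesis by simp
qed

text \<open>\<open>butlast\<close> names the clique of a vertex, so its injectivity on
  \<open>B\<close> means that \<open>B\<close> meets each clique at most once.\<close>

lemma card_open_packing_sierpinski_le:
  assumes "p \<ge> 3" and B: "open_packing (sierpinski_graph p (Suc m)) B"
  shows "card B \<le> p ^ m"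
proof -
  have V: "B \<subseteq> sierpinski_verts p (Suc m)"
    using B by (simp add: open_packing_def)
  have "inj_on butlast B"
  proof (rule inj_onI, rule ccontr)
    fix u v assume uv: "u \<in> B" "v \<in> B" "butlast u = butlast v" "u \<noteq> v"
    from uv V obtain w a where u: "u = w @ [a]" "w \<in> sierpinski_verts p m" "a \<in> {1..p}"
      by (blast elim: sierpinski_verts_SucE)
    from uv V obtain w' b where v: "v = w' @ [b]" "w' \<in> sierpinski_verts p m" "b \<in> {1..p}"
      by (blast elim: sierpinski_verts_SucE)
    from u v uv have "w' = w" by simp
    with u v clique_common_neighbour[OF assms(1) u(2) u(3) v(3)]
    have "open_nbhd (sierpinski_graph p (Suc m)) u \<inter> open_nbhd (sierpinski_graph p (Suc m)) v \<noteq> {}"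
      by blast
    with B uv show False
      by (auto simp: open_packing_def)
  qed
  moreover have "butlast ` B \<subseteq> sierpinski_verts p m"
    using V by (force elim: sierpinski_verts_SucE)
  ultimately have "card B \<le> card (sierpinski_verts p m)"
    using finite_sierpinski_verts card_inj_on_le by blast
  then show ?thesis
    by (simp add: card_sierpinski_verts)
qed

lemma card_color_class_sierpinski:
  assumes "p \<ge> 3" and f: "injective_coloring (sierpinski_graph p (Suc m)) p f" and c: "c \<in> {1..p}"
  shows "card {v \<in> sierpinski_verts p (Suc m). f v = c} = p ^ m" (is "card ?C = _")
proof (rule antisym)
  show "card ?C \<le> p ^ m"
    using card_open_packing_sierpinski_le[OF assms(1)]
      open_packing_color_class[OF pair_graph_sierpinski f] by simp
  have "sierpinski_verts p m \<subseteq> butlast ` ?C"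
  proof
    fix w assume w: "w \<in> sierpinski_verts p m"
    have "(\<lambda>a. f (w @ [a])) ` {1..p} \<subseteq> {1..p}"
      using f w by (auto simp: injective_coloring_def image_subset_iff)
    \<comment> \<open>An injective self-map of a finite set is onto, so colour \<open>c\<close>
      occurs in the clique of \<open>w\<close>.\<close>
    then have "(\<lambda>a. f (w @ [a])) ` {1..p} = {1..p}"
      using injective_coloring_inj_on_clique[OF assms(1) w f] by (simp add: endo_inj_surj)
    with c obtain a where "a \<in> {1..p}" "f (w @ [a]) = c"
      by (metis (no_types, lifting) imageE)
    with w have "w @ [a] \<in> ?C" by simp
    then show "w \<in> butlast ` ?C"
      by (metis butlast_snoc imageI)
  qed
  then have "card (sierpinski_verts p m) \<le> card ?C"
    by (intro surj_card_le) (simp_all add: finite_sierpinski_verts)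
  then show "p ^ m \<le> card ?C"
    by (simp add: card_sierpinski_verts)
qed

text \<open>Read from the right, the coefficients are 1, 1, 2, 4, ...: each one after the first is
  the sum of all those to its right.\<close>

fun dyadic_weight :: "nat list \<Rightarrow> nat" where
  "dyadic_weight [] = 0"
| "dyadic_weight [x] = x"
| "dyadic_weight (x # y # ys) = 2 ^ length ys * x + dyadic_weight (y # ys)"

lemma dyadic_weight_Cons:
  "xs \<noteq> [] \<Longrightarrow> dyadic_weight (x # xs) = 2 ^ (length xs - 1) * x + dyadic_weight xs"
  by (cases xs) simp_all

lemma dyadic_weight_replicate: "dyadic_weight (replicate (Suc r) j) = 2 ^ r * j"
  by (induction r) (simp_all add: dyadic_weight_Cons algebra_simps)

text \<open>A coefficient depends only on the distance to the right end, so \<open>w\<close>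
  contributes equally before suffixes of equal length.\<close>

lemma dyadic_weight_append_cong:
  assumes "length xs = length ys" "dyadic_weight xs = dyadic_weight ys"
  shows "dyadic_weight (w @ xs) = dyadic_weight (w @ ys)"
proof (cases "xs = []")
  case False
  with assms have "ys \<noteq> []" by auto
  with False assms show ?thesis
    by (induction w) (simp_all add: dyadic_weight_Cons)
qed (use assms in simp)

text \<open>The last coefficient is 1. The 0 is no letter of the graph but a placeholder that
  isolates the contribution of \<open>w\<close>.\<close>

lemma dyadic_weight_snoc: "dyadic_weight (w @ [a]) = dyadic_weight (w @ [0]) + a"
  by (induction w) (simp_all add: dyadic_weight_Cons)

lemma inj_on_dyadic_weight_clique:
  assumes "a \<in> {1..p}" "b \<in> {1..p}"
    and "dyadic_weight (w @ [a]) mod p = dyadic_weight (w @ [b]) mod p"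
  shows "a = b"
proof -
  have "(dyadic_weight (w @ [0]) + a) mod p = (dyadic_weight (w @ [0]) + b) mod p"
    using assms(3) dyadic_weight_snoc by metis
  then have "int p dvd int a - int b"
    by (metis add_diff_cancel_left mod_eq_dvd_iff of_nat_add of_nat_mod)
  \<comment> \<open>The letters \<open>1\<close> to \<open>p\<close> represent distinct residues
    modulo \<open>p\<close>.\<close>
  moreover have "\<bar>int a - int b\<bar> < int p"
    using assms(1,2) by auto
  ultimately show ?thesis
    by (metis dvd_imp_le_int eq_iff_diff_eq_0 abs_of_nat linorder_not_less of_nat_eq_iff)
qed

section \<open>Edges between different cliques\<close>

lemma sierpinski_adj_decomp:
  assumes "length u = n" "length v = n" "d < n" "\<forall>i<d. u ! i = v ! i"
    and "\<forall>i\<in>{d<..<n}. v ! i = u ! d \<and> u ! i = v ! d"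
  shows "u = take d u @ u ! d # replicate (n - Suc d) (v ! d)"
    and "v = take d u @ v ! d # replicate (n - Suc d) (u ! d)"
  by (rule nth_equalityI; use assms in \<open>simp add: nth_append nth_Cons split: nat.split\<close>)+

text \<open>\<open>Suc d < n\<close> says that the edge leaves the clique. Then \<open>x\<close> is
  constant after position \<open>d\<close>, so \<open>d\<close> is the last position where
  \<open>x\<close> differs from its final letter. Thus \<open>x\<close> determines \<open>d\<close>,
  and with it the other end.\<close>

lemma sierpinski_external_edge_unique:
  assumes len: "length x = n" "length u = n" "length v = n"
    and d: "Suc d < n" "\<forall>i<d. x ! i = u ! i" "x ! d \<noteq> u ! d"
      "\<forall>i\<in>{d<..<n}. u ! i = x ! d \<and> x ! i = u ! d"
    and e: "Suc e < n" "\<forall>i<e. x ! i = v ! i" "x ! e \<noteq> v ! e"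
      "\<forall>i\<in>{e<..<n}. v ! i = x ! e \<and> x ! i = v ! e"
  shows "u = v"
proof -
  have "n - 1 \<in> {d<..<n}" "n - 1 \<in> {e<..<n}"
    using d(1) e(1) by auto
  then have last: "x ! (n - 1) = u ! d" "x ! (n - 1) = v ! e"
    using d(4) e(4) by blast+
  have "\<not> d < e"
  proof
    assume "d < e"
    then have "x ! e = u ! d" using d(4) e(1) by simp
    with last e(3) show False by simp
  qed
  moreover have "\<not> e < d"
  proof
    assume "e < d"
    then have "x ! d = v ! e" using e(4) d(1) by simp
    with last d(3) show False by simp
  qed
  ultimately have "d = e" by simp
  show ?thesis
  proof (rule nth_equalityI)
    fix i assume "i < length u"
    then consider "i < d" | "i = d" | "i \<in> {d<..<n}"
      using len by force
    then show "u ! i = v ! i"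
    proof cases
      case 1
      then show ?thesis using d(2) e(2) \<open>d = e\<close> by metis
    next
      case 2
      then show ?thesis using last \<open>d = e\<close> by simp
    next
      case 3
      then show ?thesis using d(4) e(4) \<open>d = e\<close> by metis
    qed
  qed (use len in simp)
qed

lemma sierpinski_external_edge_weight:
  assumes "length x = n" "length u = n" "Suc d < n" "\<forall>i<d. x ! i = u ! i"
    and "\<forall>i\<in>{d<..<n}. u ! i = x ! d \<and> x ! i = u ! d"
  shows "dyadic_weight x = dyadic_weight u"
proof -
  \<comment> \<open>The constant block after position \<open>d\<close> has \<open>Suc r\<close>
    letters, at least one, so the letter at \<open>d\<close> has coefficient
    \<open>2 ^ r\<close>.\<close>
  define r where "r = n - Suc (Suc d)"
  have r: "n - Suc d = Suc r"
    using assms(3) by (simp add: r_def)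
  \<comment> \<open>Symmetric in \<open>i\<close> and \<open>j\<close>, so exchanging them along the
    edge keeps the weight.\<close>
  have "dyadic_weight (i # replicate (Suc r) j) = 2 ^ r * (i + j)" for i j
    using dyadic_weight_replicate[of r j]
    by (simp add: dyadic_weight_Cons algebra_simps del: replicate_Suc)
  then have "dyadic_weight (take d x @ x ! d # replicate (Suc r) (u ! d)) =
      dyadic_weight (take d x @ u ! d # replicate (Suc r) (x ! d))"
    by (intro dyadic_weight_append_cong) (simp_all add: add.commute del: replicate_Suc)
  then show ?thesis
    using sierpinski_adj_decomp[of x n u d] assms unfolding r by simp
qed

section \<open>The colouring by weights modulo \<open>p\<close>\<close>

lemma injective_coloring_dyadic_weight:
  assumes "p > 0"
  shows "injective_coloring (sierpinski_graph p (Suc m)) p (\<lambda>v. Suc (dyadic_weight v mod p))"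
proof -
  let ?V = "sierpinski_verts p (Suc m)"
  define ext where "ext x u \<longleftrightarrow> (\<exists>d. Suc d < Suc m \<and> (\<forall>i<d. x ! i = u ! i) \<and> x ! d \<noteq> u ! d \<and>
      (\<forall>i\<in>{d<..<Suc m}. u ! i = x ! d \<and> x ! i = u ! d))" for x u :: "nat list"
  have len: "length u = Suc m" if "u \<in> ?V" for u
    using that by (simp add: sierpinski_verts_def)
  have cases: "butlast x = butlast u \<or> ext x u"
    if "x \<in> ?V" "u \<in> ?V" "sierpinski_adj (Suc m) x u" for x u
  proof -
    from that(3) obtain d where d: "d < Suc m" "\<forall>i<d. x ! i = u ! i" "x ! d \<noteq> u ! d"
      "\<forall>i\<in>{d<..<Suc m}. u ! i = x ! d \<and> x ! i = u ! d"
      unfolding sierpinski_adj_def by blast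
    show ?thesis
    \<comment> \<open>Position \<open>m\<close> is the last one, so here the edge stays inside a
      clique.\<close>
    proof (cases "d = m")
      case True
      with d have "butlast x = butlast u"
        using that(1,2)[THEN len] by (intro nth_equalityI) (simp_all add: nth_butlast)
      then show ?thesis ..
    next
      case False
      with d have "ext x u"
        unfolding ext_def by (intro exI[of _ d]) simp
      then show ?thesis ..
    qed
  qed
  have clique: "u = v" if "u \<in> ?V" "v \<in> ?V" "butlast u = butlast v"
    "dyadic_weight u mod p = dyadic_weight v mod p" for u v
    using that by (auto elim!: sierpinski_verts_SucE dest: inj_on_dyadic_weight_clique)
  have weight: "dyadic_weight x = dyadic_weight u" if "x \<in> ?V" "u \<in> ?V" "ext x u" for x u
    using that sierpinski_external_edge_weight[OF that(1,2)[THEN len]] unfolding ext_def by blast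
  have unique: "u = v" if "x \<in> ?V" "u \<in> ?V" "v \<in> ?V" "ext x u" "ext x v" for x u v
    using that sierpinski_external_edge_unique[OF that(1,2,3)[THEN len]] unfolding ext_def by blast
  have "u = v" if x: "x \<in> ?V" and u: "u \<in> ?V" "sierpinski_adj (Suc m) x u"
    and v: "v \<in> ?V" "sierpinski_adj (Suc m) x v"
    and eq: "dyadic_weight u mod p = dyadic_weight v mod p" for x u v
  proof -
    have "x \<noteq> u" "x \<noteq> v"
      using u v sierpinski_adj_irrefl by auto
    \<comment> \<open>If both edges stay in the clique of \<open>x\<close>, \<open>clique\<close>
      applies; if both leave it, \<open>unique\<close> does. If only the one to \<open>u\<close>
      leaves, \<open>u\<close> has the weight of \<open>x\<close>, so \<open>v\<close> has the
      colour of \<open>x\<close> in the same clique, forcing \<open>v = x\<close>, a contradiction;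
      likewise with \<open>u\<close> and \<open>v\<close> exchanged.\<close>
    then show ?thesis
      using cases[OF x u] cases[OF x v] clique weight unique x u(1) v(1) eq by metis
  qed
  moreover have "(\<lambda>v. Suc (dyadic_weight v mod p)) ` ?V \<subseteq> {1..p}"
    using assms by (auto simp: Suc_le_eq)
  ultimately show ?thesis
    unfolding injective_coloring_def
    by (auto simp: open_nbhd_sierpinski)
qed

theorem theorem3p1:
  fixes p n :: nat
  assumes "p \<ge> 3" and "n \<ge> 1"
  shows "injective_chromatic_number (sierpinski_graph p n) = p
    \<and> perfect_injectively_colorable (sierpinski_graph p n)"
proof -
  obtain m where n: "n = Suc m"
    using \<open>n \<ge> 1\<close> by (cases n) auto
  let ?G = "sierpinski_graph p (Suc m)"
  obtain f where f: "injective_coloring ?G p f"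
    using injective_coloring_dyadic_weight[of p m] assms(1) by auto
  have "injective_chromatic_number ?G = p"
    unfolding injective_chromatic_number_def
    using f injective_coloring_sierpinski_ge[OF assms(1)] by (intro Least_equality) blast+
  moreover have packing: "open_packing ?G {v \<in> pverts ?G. f v = c}" for c
    by (rule open_packing_color_class[OF pair_graph_sierpinski f])
  moreover have card: "card {v \<in> pverts ?G. f v = c} = p ^ m" if "c \<in> {1..p}" for c
    using card_color_class_sierpinski[OF assms(1) f that] by simp
  moreover have "open_packing_number ?G = p ^ m"
  proof (rule antisym)
    show "open_packing_number ?G \<le> p ^ m"
      using open_packing_number_attained(1)[OF pair_graph_sierpinski]
        card_open_packing_sierpinski_le[OF assms(1)] by metis
    \<comment> \<open>A single colour class gives the lower bound; colour 1 is available.\<close>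
    have "1 \<in> {1..p}"
      using assms(1) by simp
    then show "p ^ m \<le> open_packing_number ?G"
      using open_packing_number_attained(2)[OF pair_graph_sierpinski packing] card by metis
  qed
  ultimately show ?thesis
    using f unfolding n perfect_injectively_colorable_def
    by (intro conjI exI[of _ p] exI[of _ f]) simp_all
qed

end
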